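(* Let $N_1(n,k)$ be the number of $n$-bit partial Boolean functions that depend on $k$ bits and have exact quantum query complexity $1$ (i.e. are non-constant and can be computed exactly by a quantum 1-query algorithm). If $n\ge3$ and $k\ge2$, then $$N_1(n,k)\le n^2\,2^{2^{n-1}(1+2^{2-k})+2n^2}.$$
   Context: An $n$-bit partial Boolean function is a map $f:D\to\{0,1\}$ with $D\subseteq\{0,1\}^n$ (equivalently a string in $\{0,1,*\}^{2^n}$). $f$ depends on $k$ bits if $k$ is the minimum, over all multilinear polynomials $p$ with $p(x)=f(x)$ for all $x\in D$, of the number of variables occurring in $p$. A quantum 1-query algorithm works in a finite-dimensional Hilbert space with orthonormal basis $\{|i,j'\rangle\}$, $i\in\{0,\dots,n\}$; the oracle is $O_x|i,j'\rangle=(-1)^{x_i}|i,j'\rangle$ for $i\ge1$, $O_x|0,j'\rangle=|0,j'\rangle$; the algorithm applies input-independent unitaries $U_0,O_x,U_1$ to an initial state and performs a projective measurement with outcomes in $\{0,1\}$; it computes $f$ exactly if for every $x\in D$ the outcome is $f(x)$ with probability 1. *)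

theory Defs
  imports Complex_Main
begin

text \<open>An n-bit input x is a bool list of length n (bit i+1 of the paper is x!i).
  An n-bit partial Boolean function is f :: bool list \<Rightarrow> bool option with
  f x = None for every x of length \<noteq> n; its domain D is the set of length-n
  x with f x \<noteq> None.  Such f correspond bijectively to strings in {0,1,*}^(2^n).\<close>

definition pbf :: "nat \<Rightarrow> (bool list \<Rightarrow> bool option) set" where
  "pbf n = {f. \<forall>x. length x \<noteq> n \<longrightarrow> f x = None}"

definition dom_pbf :: "nat \<Rightarrow> (bool list \<Rightarrow> bool option) \<Rightarrow> bool list set" where
  "dom_pbf n f = {x. length x = n \<and> f x \<noteq> None}"

definition mlpoly_eval :: "nat \<Rightarrow> (nat set \<Rightarrow> real) \<Rightarrow> bool list \<Rightarrow> real" where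
  "mlpoly_eval n c x = (\<Sum>S\<in>Pow {0..<n}. c S * (\<Prod>i\<in>S. (if x ! i then 1 else 0)))"

definition mlpoly_vars :: "nat \<Rightarrow> (nat set \<Rightarrow> real) \<Rightarrow> nat set" where
  "mlpoly_vars n c = \<Union>{S \<in> Pow {0..<n}. c S \<noteq> 0}"

definition represents :: "nat \<Rightarrow> (nat set \<Rightarrow> real) \<Rightarrow> (bool list \<Rightarrow> bool option) \<Rightarrow> bool" where
  "represents n c f = (\<forall>x\<in>dom_pbf n f.
      mlpoly_eval n c x = (if f x = Some True then 1 else 0))"

definition depends_on_bits :: "nat \<Rightarrow> (bool list \<Rightarrow> bool option) \<Rightarrow> nat \<Rightarrow> bool" where
  "depends_on_bits n f k =
     (k = (LEAST m. \<exists>c. represents n c f \<and> card (mlpoly_vars n c) = m))"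

definition non_constant :: "nat \<Rightarrow> (bool list \<Rightarrow> bool option) \<Rightarrow> bool" where
  "non_constant n f = (\<exists>x\<in>dom_pbf n f. \<exists>y\<in>dom_pbf n f. f x \<noteq> f y)"

definition mat_mul :: "nat \<Rightarrow> (nat \<Rightarrow> nat \<Rightarrow> complex) \<Rightarrow> (nat \<Rightarrow> nat \<Rightarrow> complex) \<Rightarrow> nat \<Rightarrow> nat \<Rightarrow> complex" where
  "mat_mul d A B i j = (\<Sum>k<d. A i k * B k j)"

definition mat_vec :: "nat \<Rightarrow> (nat \<Rightarrow> nat \<Rightarrow> complex) \<Rightarrow> (nat \<Rightarrow> complex) \<Rightarrow> nat \<Rightarrow> complex" where
  "mat_vec d A v i = (\<Sum>k<d. A i k * v k)"

definition vnorm2 :: "nat \<Rightarrow> (nat \<Rightarrow> complex) \<Rightarrow> real" where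
  "vnorm2 d v = (\<Sum>k<d. (cmod (v k))\<^sup>2)"

definition id_mat :: "nat \<Rightarrow> nat \<Rightarrow> complex" where
  "id_mat i j = (if i = j then 1 else 0)"

definition adj :: "(nat \<Rightarrow> nat \<Rightarrow> complex) \<Rightarrow> nat \<Rightarrow> nat \<Rightarrow> complex" where
  "adj A i j = cnj (A j i)"

definition unitary :: "nat \<Rightarrow> (nat \<Rightarrow> nat \<Rightarrow> complex) \<Rightarrow> bool" where
  "unitary d U = (\<forall>i<d. \<forall>j<d. mat_mul d (adj U) U i j = id_mat i j
                              \<and> mat_mul d U (adj U) i j = id_mat i j)"

definition orth_proj :: "nat \<Rightarrow> (nat \<Rightarrow> nat \<Rightarrow> complex) \<Rightarrow> bool" where
  "orth_proj d P = (\<forall>i<d. \<forall>j<d. P i j = adj P i j \<and> mat_mul d P P i j = P i j)"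

definition proj_meas :: "nat \<Rightarrow> (bool \<Rightarrow> nat \<Rightarrow> nat \<Rightarrow> complex) \<Rightarrow> bool" where
  "proj_meas d P = (orth_proj d (P False) \<and> orth_proj d (P True) \<and>
     (\<forall>i<d. \<forall>j<d. P False i j + P True i j = id_mat i j))"

text \<open>Hilbert space C^((n+1)*m) with basis |i,j'\<rangle>, i \<in> {0..n}, j' < m, encoded as
  index i*m + j'.  The query operator is O_x |i,j'\<rangle> = (-1)^(x_i) |i,j'\<rangle> for i \<ge> 1
  (x_i = x ! (i-1)) and O_x |0,j'\<rangle> = |0,j'\<rangle>.\<close>

definition query_op :: "nat \<Rightarrow> bool list \<Rightarrow> nat \<Rightarrow> nat \<Rightarrow> complex" where
  "query_op m x a b = (if a = b then
       (let i = a div m in if i \<ge> 1 \<and> x ! (i - 1) then -1 else 1)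
     else 0)"

definition final_state :: "nat \<Rightarrow> nat \<Rightarrow> (nat \<Rightarrow> nat \<Rightarrow> complex) \<Rightarrow> (nat \<Rightarrow> nat \<Rightarrow> complex)
    \<Rightarrow> (nat \<Rightarrow> complex) \<Rightarrow> bool list \<Rightarrow> nat \<Rightarrow> complex" where
  "final_state n m U0 U1 \<psi> x =
     (let d = (n + 1) * m in mat_vec d U1 (mat_vec d (query_op m x) (mat_vec d U0 \<psi>)))"

definition exact_1query :: "nat \<Rightarrow> (bool list \<Rightarrow> bool option) \<Rightarrow> bool" where
  "exact_1query n f = (\<exists>m::nat. \<exists>U0 U1 \<psi> P.
     (let d = (n + 1) * m in
       0 < m \<and> unitary d U0 \<and> unitary d U1 \<and> vnorm2 d \<psi> = 1 \<and> proj_meas d P \<and>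
       (\<forall>x\<in>dom_pbf n f.
          vnorm2 d (mat_vec d (P (the (f x))) (final_state n m U0 U1 \<psi> x)) = 1)))"

definition N1 :: "nat \<Rightarrow> nat \<Rightarrow> nat" where
  "N1 n k = card {f \<in> pbf n. depends_on_bits n f k \<and> non_constant n f \<and> exact_1query n f}"

end

theory Submission
  imports Defs
begin

text \<open>Let \<open>w i\<close> be the probability of querying position \<open>i\<close>, and identify an input \<open>x\<close> with the
  sign vector \<open>((-1) ^ x i)\<close>, extended by a constant entry at \<open>i = 0\<close>. Exactness forces the
  final states of inputs with different values to be orthogonal, that is, the sign vectors of 0-inputs
  and of 1-inputs are orthogonal for the weights \<open>w\<close>. This remains true for all sign
  vectors in the linear spans of the two sets. Each span lies in a hyperplane of
  \<open>n + 1\<close>-dimensional space, so it is generated by \<open>n\<close> inputs, which gives at most \<open>2 ^ (2 * n\<^sup>2)\<close>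
  pairs of spans. If \<open>r\<close> weights are nonzero, two orthogonal families have product of sizes at most
  \<open>2 ^ r\<close> (up to the free coordinates of weight zero); as both are closed under
  negation, convexity bounds the sum of their sizes. Finally \<open>k \<le> r\<close>, because \<open>f\<close> only depends on the
  bits of nonzero weight, and \<open>f\<close> is a choice of one subset from each of the two families.\<close>

section \<open>Linear systems and generating subsets\<close>

text \<open>Gaussian elimination by induction on the equations: a pivot \<open>p\<close> clears
  equation \<open>j\<close> from the other unknowns, and its own coefficient is restored at the
  end.\<close>

lemma homogeneous_system_nontrivial_solution:
  fixes a :: "'i \<Rightarrow> 'j \<Rightarrow> real"
  assumes "finite J" "finite I" "card J < card I"
  shows "\<exists>c. (\<exists>i\<in>I. c i \<noteq> 0) \<and> (\<forall>j\<in>J. (\<Sum>i\<in>I. c i * a i j) = 0)"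
  using assms
proof (induction J arbitrary: I a rule: finite_induct)
  case empty
  then obtain i where "i \<in> I"
    by fastforce
  then show ?case
    by (intro exI[of _ "\<lambda>_. 1"]) auto
next
  case (insert j J)
  show ?case
  proof (cases "\<forall>i\<in>I. a i j = 0")
    case True
    have "card J < card I"
      using insert by simp
    then show ?thesis
      using insert.IH[of I a] insert.prems True by auto
  next
    case False
    then obtain p where p: "p \<in> I" "a p j \<noteq> 0"
      by blast
    define I' where "I' = I - {p}"
    have I: "I = insert p I'" "p \<notin> I'" "finite I'"
      using p insert.prems by (auto simp: I'_def)
    have "card J < card I'"
      using insert.prems insert.hyps I by simp
    then obtain c where c: "\<exists>i\<in>I'. c i \<noteq> 0"
      "\<And>j'. j' \<in> J \<Longrightarrow> (\<Sum>i\<in>I'. c i * (a i j' - a i j / a p j * a p j')) = 0"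
      using insert.IH[of I' "\<lambda>i j'. a i j' - a i j / a p j * a p j'"] I by blast
    \<comment> \<open>The coefficient \<open>- s\<close> at the pivot is what equation
      \<open>j\<close> forces; with it, every other equation reduces to its eliminated form.\<close>
    define s where "s = (\<Sum>i\<in>I'. c i * (a i j / a p j))"
    define c' where "c' = c(p := - s)"
    have sum: "(\<Sum>i\<in>I. c' i * a i j') = (\<Sum>i\<in>I'. c i * a i j') - s * a p j'" for j'
    proof -
      have "(\<Sum>i\<in>I'. c' i * a i j') = (\<Sum>i\<in>I'. c i * a i j')"
        using I by (intro sum.cong) (auto simp: c'_def)
      then show ?thesis
        using I by (simp add: c'_def)
    qed
    have "(\<Sum>i\<in>I. c' i * a i j') = 0" if "j' \<in> J" for j'
      using c(2)[OF that] unfolding sum s_def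
      by (simp add: right_diff_distrib sum_subtractf sum_distrib_right mult.assoc)
    moreover have "(\<Sum>i\<in>I. c' i * a i j) = 0"
      unfolding sum s_def using p by (simp add: sum_distrib_right)
    moreover have "\<exists>i\<in>I. c' i \<noteq> 0"
      using c(1) I by (auto simp: c'_def)
    ultimately show ?thesis
      by blast
  qed
qed

text \<open>Take \<open>G\<close> of least size that imposes the same linear conditions as
  \<open>A\<close>. With \<open>card E\<close> or more members it would have a dependency on the
  coordinates other than \<open>e\<close>; the hyperplane extends it to \<open>e\<close> because
  \<open>v e \<noteq> 0\<close>, so some member could be dropped.\<close>

lemma generating_subset_of_hyperplane:
  fixes \<phi> :: "'b \<Rightarrow> 'i \<Rightarrow> real"
  assumes "finite A" "finite E" and e: "e \<in> E" "v e \<noteq> 0"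
    and hyp: "\<And>x. x \<in> A \<Longrightarrow> (\<Sum>i\<in>E. v i * \<phi> x i) = 0"
  shows "\<exists>G\<subseteq>A. card G < card E \<and>
    (\<forall>u. (\<forall>g\<in>G. (\<Sum>i\<in>E. u i * \<phi> g i) = 0) \<longrightarrow> (\<forall>x\<in>A. (\<Sum>i\<in>E. u i * \<phi> x i) = 0))"
proof -
  define Q where "Q G \<longleftrightarrow> G \<subseteq> A \<and>
    (\<forall>u. (\<forall>g\<in>G. (\<Sum>i\<in>E. u i * \<phi> g i) = 0) \<longrightarrow> (\<forall>x\<in>A. (\<Sum>i\<in>E. u i * \<phi> x i) = 0))" for G
  have "Q A"
    by (auto simp: Q_def)
  define G where "G = arg_min card Q"
  have QG: "Q G" and min: "\<And>H. Q H \<Longrightarrow> card G \<le> card H"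
    using arg_min_natI[of Q A card] arg_min_nat_le[of Q _ card] \<open>Q A\<close> by (auto simp: G_def)
  have "finite G"
    using QG \<open>finite A\<close> by (auto simp: Q_def intro: finite_subset)
  have "card G < card E"
  proof (rule ccontr)
    assume "\<not> card G < card E"
    \<comment> \<open>Leaving out coordinate \<open>e\<close> saves one equation; the strict bound
      comes from here.\<close>
    then have "card (E - {e}) < card G"
      using e assms(2) by (metis card_Diff1_less linorder_not_less order_less_le_trans)
    then obtain c g where g: "g \<in> G" "c g \<noteq> 0"
      and c: "\<And>j. j \<in> E - {e} \<Longrightarrow> (\<Sum>h\<in>G. c h * \<phi> h j) = 0"
      using homogeneous_system_nontrivial_solution[of "E - {e}" G \<phi>] \<open>finite G\<close> assms(2) by blast
    have swap: "(\<Sum>i\<in>E. u i * (\<Sum>h\<in>G. c h * \<phi> h i)) = (\<Sum>h\<in>G. c h * (\<Sum>i\<in>E. u i * \<phi> h i))" for u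
      unfolding sum_distrib_left by (subst sum.swap) (simp add: ac_simps)
    \<comment> \<open>Pairing the dependency with \<open>v\<close> gives zero, and only the term at
      \<open>e\<close> survives, so the dependency holds at \<open>e\<close> too.\<close>
    have "(\<Sum>i\<in>E. v i * (\<Sum>h\<in>G. c h * \<phi> h i)) = 0"
      unfolding swap using hyp QG by (intro sum.neutral) (auto simp: Q_def)
    moreover have "(\<Sum>i\<in>E. v i * (\<Sum>h\<in>G. c h * \<phi> h i)) = v e * (\<Sum>h\<in>G. c h * \<phi> h e)"
      using c e(1) assms(2) by (simp add: sum.remove)
    ultimately have c0: "(\<Sum>h\<in>G. c h * \<phi> h j) = 0" if "j \<in> E" for j
      using c e(2) that by (cases "j = e") auto
    have "Q (G - {g})"
      unfolding Q_def
    proof (intro conjI allI impI)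
      show "G - {g} \<subseteq> A"
        using QG by (auto simp: Q_def)
      fix u assume u: "\<forall>h\<in>G - {g}. (\<Sum>i\<in>E. u i * \<phi> h i) = 0"
      have "0 = (\<Sum>i\<in>E. u i * (\<Sum>h\<in>G. c h * \<phi> h i))"
        using c0 by simp
      also have "\<dots> = c g * (\<Sum>i\<in>E. u i * \<phi> g i)"
        unfolding swap using u g(1) \<open>finite G\<close> by (simp add: sum.remove)
      finally have "\<forall>h\<in>G. (\<Sum>i\<in>E. u i * \<phi> h i) = 0"
        using u g by auto
      then show "\<forall>x\<in>A. (\<Sum>i\<in>E. u i * \<phi> x i) = 0"
        using QG by (auto simp: Q_def)
    qed
    from min[OF this] show False
      using g(1) \<open>finite G\<close> by (metis card_Diff1_less linorder_not_less)
  qed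
  then show ?thesis
    using QG unfolding Q_def by blast
qed

section \<open>Orthogonal families of sign vectors\<close>

definition chi :: "'i set \<Rightarrow> 'i \<Rightarrow> real" where
  "chi X i = (if i \<in> X then -1 else 1)"

definition orth :: "'i set \<Rightarrow> ('i \<Rightarrow> real) \<Rightarrow> 'i set \<Rightarrow> 'i set \<Rightarrow> bool" where
  "orth E w X Y \<longleftrightarrow> (\<Sum>i\<in>E. w i * chi X i * chi Y i) = 0"

text \<open>The linear span, as a double orthogonal complement.\<close>

definition sign_span :: "'i set \<Rightarrow> 'i set set \<Rightarrow> 'i set set" where
  "sign_span E G = {X. \<forall>u. (\<forall>Y\<in>G. (\<Sum>i\<in>E. u i * chi Y i) = 0) \<longrightarrow> (\<Sum>i\<in>E. u i * chi X i) = 0}"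

lemma orth_sym: "orth E w X Y \<longleftrightarrow> orth E w Y X"
  by (simp add: orth_def ac_simps)

lemma orth_cong:
  assumes "\<And>i. i \<in> E \<Longrightarrow> w i \<noteq> 0 \<Longrightarrow> i \<in> X \<longleftrightarrow> i \<in> X'"
  shows "orth E w X Y \<longleftrightarrow> orth E w X' Y"
proof -
  have "(\<Sum>i\<in>E. w i * chi X i * chi Y i) = (\<Sum>i\<in>E. w i * chi X' i * chi Y i)"
    using assms by (intro sum.cong) (auto simp: chi_def)
  then show ?thesis
    by (simp add: orth_def)
qed

text \<open>On \<open>E\<close>, complementation negates the sign vector.\<close>

lemma orth_Compl: "orth E w (E - X) Y \<longleftrightarrow> orth E w X Y"
proof -
  have "(\<Sum>i\<in>E. w i * chi (E - X) i * chi Y i) = (\<Sum>i\<in>E. - (w i * chi X i * chi Y i))"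
    by (intro sum.cong) (auto simp: chi_def)
  then show ?thesis
    by (simp add: orth_def sum_negf)
qed

text \<open>The span quantifies over all functionals, in particular over
  \<open>u i = w i * chi Y i\<close>.\<close>

lemma orth_sign_span_left:
  assumes "\<And>X. X \<in> G \<Longrightarrow> orth E w X Y" "X \<in> sign_span E G"
  shows "orth E w X Y"
proof -
  have eq: "(\<Sum>i\<in>E. (w i * chi Y i) * chi Z i) = 0 \<longleftrightarrow> orth E w Z Y" for Z
    by (simp add: orth_def ac_simps)
  have "(\<forall>Z\<in>G. (\<Sum>i\<in>E. (w i * chi Y i) * chi Z i) = 0) \<longrightarrow>
    (\<Sum>i\<in>E. (w i * chi Y i) * chi X i) = 0"
    using assms(2) unfolding sign_span_def mem_Collect_eq by (rule spec)
  then show ?thesis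
    unfolding eq using assms(1) by simp
qed

lemma orth_sign_span:
  assumes "\<And>X Y. X \<in> G \<Longrightarrow> Y \<in> H \<Longrightarrow> orth E w X Y"
    and "X \<in> sign_span E G" "Y \<in> sign_span E H"
  shows "orth E w X Y"
proof (rule orth_sign_span_left[OF _ assms(2)])
  fix X assume "X \<in> G"
  then have "orth E w Y X"
    using assms(1) by (intro orth_sign_span_left[OF _ assms(3)]) (simp add: orth_sym[of E w _ X])
  then show "orth E w X Y"
    by (simp only: orth_sym[of E w X])
qed

section \<open>Sizes of orthogonal families\<close>

lemma card_le_of_determining_set:
  assumes "finite K" "\<And>X Y. X \<in> F \<Longrightarrow> Y \<in> F \<Longrightarrow> X \<inter> K = Y \<inter> K \<Longrightarrow> X = Y"
  shows "card F \<le> 2 ^ card K"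
proof -
  have "inj_on (\<lambda>X. X \<inter> K) F"
    using assms(2) by (auto simp: inj_on_def)
  moreover have "(\<lambda>X. X \<inter> K) ` F \<subseteq> Pow K"
    by auto
  ultimately have "card F \<le> card (Pow K)"
    using assms(1) by (metis card_inj_on_le finite_Pow_iff)
  then show ?thesis
    using assms(1) by (simp add: card_Pow)
qed

text \<open>Take a maximal set \<open>I\<close> of coordinates in the support that are linearly independent as
  functionals on \<open>\<A>\<close>. The coordinates in \<open>I\<close> determine the elements of \<open>\<A>\<close>, and the remaining
  ones determine those of \<open>\<B>\<close>, because the difference of two elements of \<open>\<B>\<close> is orthogonal
  to \<open>\<A>\<close>. Coordinates of weight zero are free in both families.\<close>

lemma card_orthogonal_families:
  assumes "finite E" "\<A> \<subseteq> Pow E" "\<B> \<subseteq> Pow E"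
    and orth: "\<And>X Y. X \<in> \<A> \<Longrightarrow> Y \<in> \<B> \<Longrightarrow> orth E w X Y"
    and R: "R = {i\<in>E. w i \<noteq> 0}"
  shows "card \<A> * card \<B> \<le> 2 ^ card R * 4 ^ card (E - R)"
proof -
  define ind where "ind I \<longleftrightarrow> I \<subseteq> R \<and>
    (\<forall>u. (\<forall>i. i \<notin> I \<longrightarrow> u i = 0) \<longrightarrow> (\<forall>X\<in>\<A>. (\<Sum>i\<in>E. u i * chi X i) = 0) \<longrightarrow> (\<forall>i. u i = 0))" for I
  have "finite R"
    using R assms(1) by simp
  have "ind {}"
    by (simp add: ind_def)
  moreover have "\<forall>I. ind I \<longrightarrow> card I < Suc (card R)"
    using \<open>finite R\<close> by (auto simp: ind_def less_Suc_eq_le intro: card_mono)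
  ultimately obtain I where I: "ind I" and max: "\<And>J. ind J \<Longrightarrow> card J \<le> card I"
    using ex_has_greatest_nat[of ind "{}" card "Suc (card R)"] by auto
  have "I \<subseteq> R" "R \<subseteq> E" "finite I"
    using I R \<open>finite R\<close> by (auto simp: ind_def intro: finite_subset)
  have det: "j \<in> X \<longleftrightarrow> j \<in> Y"
    if XY: "X \<in> \<A>" "Y \<in> \<A>" "X \<inter> I = Y \<inter> I" and j: "j \<in> R - I" for X Y j
  proof -
    have "\<not> ind (insert j I)"
      using max[of "insert j I"] j \<open>finite I\<close> by auto
    then obtain u where u: "\<And>i. i \<notin> insert j I \<Longrightarrow> u i = 0"
      "\<And>X. X \<in> \<A> \<Longrightarrow> (\<Sum>i\<in>E. u i * chi X i) = 0" "\<exists>i. u i \<noteq> 0"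
      using j \<open>I \<subseteq> R\<close> unfolding ind_def by auto
    \<comment> \<open>Otherwise \<open>u\<close> would be supported on \<open>I\<close>, against the
      independence of \<open>I\<close>.\<close>
    have "u j \<noteq> 0"
    proof
      assume "u j = 0"
      then have "\<forall>i. i \<notin> I \<longrightarrow> u i = 0"
        using u(1) by (metis insertE)
      then show False
        using I u(2,3) unfolding ind_def by blast
    qed
    have "0 = (\<Sum>i\<in>E. u i * chi X i) - (\<Sum>i\<in>E. u i * chi Y i)"
      using u(2) XY by simp
    also have "\<dots> = (\<Sum>i\<in>E. u i * (chi X i - chi Y i))"
      by (simp add: sum_subtractf right_diff_distrib)
    also have "\<dots> = (\<Sum>i\<in>{j}. u i * (chi X i - chi Y i))"
    proof (rule sum.mono_neutral_right)
      show "\<forall>i\<in>E - {j}. u i * (chi X i - chi Y i) = 0"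
      proof
        fix i assume "i \<in> E - {j}"
        then show "u i * (chi X i - chi Y i) = 0"
          using u(1)[of i] XY(3) by (cases "i \<in> I") (auto simp: chi_def)
      qed
    qed (use assms(1) j \<open>R \<subseteq> E\<close> in auto)
    finally have "chi X j = chi Y j"
      using \<open>u j \<noteq> 0\<close> by simp
    then show ?thesis
      by (auto simp: chi_def split: if_splits)
  qed
  have "card \<A> \<le> 2 ^ card (I \<union> (E - R))"
  proof (rule card_le_of_determining_set)
    fix X Y assume XY: "X \<in> \<A>" "Y \<in> \<A>" and eq: "X \<inter> (I \<union> (E - R)) = Y \<inter> (I \<union> (E - R))"
    then have "X \<inter> I = Y \<inter> I"
      by blast
    note d = det[OF XY this]
    have "X \<subseteq> E" "Y \<subseteq> E"
      using XY assms(2) by auto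
    then show "X = Y"
      using eq d by blast
  qed (use \<open>finite I\<close> assms(1) in auto)
  moreover have "card \<B> \<le> 2 ^ card ((R - I) \<union> (E - R))"
  proof (rule card_le_of_determining_set)
    fix X Y assume XY: "X \<in> \<B>" "Y \<in> \<B>"
      and eq: "X \<inter> ((R - I) \<union> (E - R)) = Y \<inter> ((R - I) \<union> (E - R))"
    \<comment> \<open>This weighted difference is supported on \<open>I\<close>: the two sets agree
      on \<open>R - I\<close>, and \<open>w\<close> vanishes off \<open>R\<close>. Since it
      annihilates \<open>\<A>\<close>, independence makes it zero, and dividing by \<open>w\<close>
      gives agreement on all of \<open>R\<close>.\<close>
    define u where "u i = (if i \<in> E then w i * (chi X i - chi Y i) else 0)" for i
    have "u i = 0" if "i \<notin> I" for i
      using eq that R by (auto simp: u_def chi_def)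
    moreover have "(\<Sum>i\<in>E. u i * chi Z i) = 0" if "Z \<in> \<A>" for Z
    proof -
      have "(\<Sum>i\<in>E. u i * chi Z i) =
        (\<Sum>i\<in>E. w i * chi Z i * chi X i) - (\<Sum>i\<in>E. w i * chi Z i * chi Y i)"
        by (simp add: u_def algebra_simps sum_subtractf[symmetric])
      then show ?thesis
        using orth[OF that] XY by (simp add: orth_def)
    qed
    ultimately have u0: "u i = 0" for i
      using I unfolding ind_def by blast
    have d: "i \<in> X \<longleftrightarrow> i \<in> Y" if "i \<in> R" for i
      using that R u0[of i] by (auto simp: u_def chi_def split: if_splits)
    have "X \<subseteq> E" "Y \<subseteq> E"
      using XY assms(3) by auto
    then show "X = Y"
      using eq d by blast
  qed (use \<open>finite R\<close> assms(1) in auto)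
  ultimately have "card \<A> * card \<B> \<le> 2 ^ card (I \<union> (E - R)) * 2 ^ card ((R - I) \<union> (E - R))"
    by (rule mult_le_mono)
  also have "card (I \<union> (E - R)) = card I + card (E - R)"
    using \<open>finite I\<close> \<open>I \<subseteq> R\<close> assms(1) by (intro card_Un_disjoint) auto
  also have "card ((R - I) \<union> (E - R)) = card (R - I) + card (E - R)"
    using \<open>finite R\<close> assms(1) by (intro card_Un_disjoint) auto
  also have "(2::nat) ^ (card I + card (E - R)) * 2 ^ (card (R - I) + card (E - R)) =
    2 ^ (card I + card (R - I)) * (2 ^ 2) ^ card (E - R)"
    by (simp only: power_add power_mult[symmetric] mult_2 ac_simps)
  also have "card I + card (R - I) = card R"
    using \<open>finite R\<close> \<open>I \<subseteq> R\<close> by (metis card_Diff_subset card_mono finite_subset le_add_diff_inverse)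
  finally show ?thesis
    by simp
qed

text \<open>One orthogonal \<open>X\<close> yields many: keep or flip all of its coordinates in
  \<open>R\<close>, and choose those of weight zero freely. As \<open>R\<close> is nonempty, the two
  choices on \<open>R\<close> differ, whence the \<open>+ 1\<close> in the exponent.\<close>

lemma card_orthogonal_complement_ge:
  assumes "finite E" and R: "R = {i\<in>E. w i \<noteq> 0}" "R \<noteq> {}"
    and X: "\<And>Y. Y \<in> \<B> \<Longrightarrow> orth E w X Y"
  shows "2 ^ (card (E - R) + 1) \<le> card {X. X \<subseteq> E \<and> (\<forall>Y\<in>\<B>. orth E w X Y)}" (is "_ \<le> card ?A")
proof -
  define A1 where "A1 = (\<lambda>F. (X \<inter> R) \<union> F) ` Pow (E - R)"
  define A2 where "A2 = (\<lambda>F. (R - X) \<union> F) ` Pow (E - R)"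
  have fin: "finite (E - R)" "finite ?A"
    using assms(1) by auto
  have "A1 \<subseteq> ?A"
  proof -
    have "orth E w (X \<inter> R \<union> F) Y" if "F \<subseteq> E - R" "Y \<in> \<B>" for F Y
      using X[OF that(2)] that(1) R by (subst orth_cong[of _ _ _ X]) auto
    then show ?thesis
      using R by (auto simp: A1_def)
  qed
  moreover have "A2 \<subseteq> ?A"
  proof -
    have "orth E w (R - X \<union> F) Y" if "F \<subseteq> E - R" "Y \<in> \<B>" for F Y
      using X[OF that(2)] that(1) R by (subst orth_cong[of _ _ _ "E - X"]) (auto simp: orth_Compl)
    then show ?thesis
      using R by (auto simp: A2_def)
  qed
  moreover have "A1 \<inter> A2 = {}"
    using R(2) by (auto simp: A1_def A2_def)
  moreover have "card A1 = 2 ^ card (E - R)" "card A2 = 2 ^ card (E - R)"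
    unfolding A1_def A2_def using fin(1)
    by (subst card_image; auto simp: inj_on_def card_Pow)+
  moreover have "finite A1" "finite A2"
    using fin by (auto simp: A1_def A2_def)
  ultimately have "2 ^ card (E - R) + 2 ^ card (E - R) \<le> card ?A"
    using card_mono[OF fin(2), of "A1 \<union> A2"] card_Un_disjoint[of A1 A2] by auto
  then show ?thesis
    by simp
qed

text \<open>With the product bounded and both factors at least \<open>t\<close>, the sum is largest
  when one factor equals \<open>t\<close> and the other \<open>u\<close>.\<close>

lemma sum_le_of_prod_le:
  fixes p q t u :: real
  assumes "t > 0" "t \<le> p" "t \<le> q" "p * q \<le> t * u"
  shows "p + q \<le> t + u"
proof -
  have "0 \<le> (p - t) * (q - t)"
    using assms by simp
  then have "t * (p + q) \<le> t * (t + u)"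
    using assms(4) by (simp add: algebra_simps)
  then show ?thesis
    using assms(1) by simp
qed

text \<open>Members of \<open>\<A>0\<close> omit \<open>e\<close> and their complements contain it,
  so the two halves are disjoint.\<close>

lemma double_card_le:
  assumes "finite E" "e \<in> E" "\<A>0 \<subseteq> Pow (E - {e})" "\<A>0 \<subseteq> \<A>" "\<A> \<subseteq> Pow E"
    and "\<And>X. X \<in> \<A> \<Longrightarrow> E - X \<in> \<A>"
  shows "2 * card \<A>0 \<le> card \<A>"
proof -
  define \<A>1 where "\<A>1 = (\<lambda>X. E - X) ` \<A>0"
  have fin: "finite \<A>"
    using finite_subset[OF assms(5)] assms(1) by simp
  have fin0: "finite \<A>0"
    using finite_subset[OF assms(4) fin] .
  have "inj_on (\<lambda>X. E - X) \<A>0"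
  proof (rule inj_onI)
    fix X Y assume "X \<in> \<A>0" "Y \<in> \<A>0" "E - X = E - Y"
    moreover from this have "X \<subseteq> E" "Y \<subseteq> E"
      using assms(3) by auto
    ultimately show "X = Y"
      by (metis double_diff subset_refl)
  qed
  then have "card \<A>1 = card \<A>0"
    unfolding \<A>1_def by (rule card_image)
  moreover have "\<A>0 \<inter> \<A>1 = {}"
    using assms(2,3) by (auto simp: \<A>1_def)
  moreover have "\<A>0 \<union> \<A>1 \<subseteq> \<A>"
    using assms(4,6) by (auto simp: \<A>1_def)
  moreover have "finite \<A>1"
    using fin0 by (simp add: \<A>1_def)
  ultimately show ?thesis
    using card_mono[OF fin, of "\<A>0 \<union> \<A>1"] fin0 by (simp add: card_Un_disjoint)
qed

text \<open>Coordinate 0 carries the sign of the vector: adding all negatives doubles both families and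
  makes their maximal extensions closed under negation, also when \<open>w 0 = 0\<close>.\<close>

lemma card_sum_orthogonal_families:
  fixes w :: "nat \<Rightarrow> real"
  assumes "\<A>0 \<subseteq> Pow {1..n}" "\<B>0 \<subseteq> Pow {1..n}" "\<A>0 \<noteq> {}" "\<B>0 \<noteq> {}"
    and orth: "\<And>X Y. X \<in> \<A>0 \<Longrightarrow> Y \<in> \<B>0 \<Longrightarrow> orth {0..n} w X Y"
    and R: "R = {i\<in>{0..n}. w i \<noteq> 0}" "R \<noteq> {}"
  shows "real (card \<A>0 + card \<B>0) \<le> 2 powr (real n + 1 - real (card R)) + 2 powr (real n - 1)"
proof -
  define E where "E = {0..n}"
  \<comment> \<open>Passing to the orthogonal complement and then to its complement makes both
    families orthogonal complements, so the lower bound \<open>t\<close> below applies to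
    each.\<close>
  define \<A> where "\<A> = {X. X \<subseteq> E \<and> (\<forall>Y\<in>\<B>0. orth E w X Y)}"
  define \<B> where "\<B> = {Y. Y \<subseteq> E \<and> (\<forall>X\<in>\<A>. orth E w Y X)}"
  define r where "r = card R"
  have E: "finite E" "0 \<in> E" "{1..n} = E - {0}"
    by (auto simp: E_def)
  have RE: "R = {i\<in>E. w i \<noteq> 0}"
    using R by (simp add: E_def)
  have sub: "\<A>0 \<subseteq> \<A>" "\<B>0 \<subseteq> \<B>"
  proof -
    show "\<A>0 \<subseteq> \<A>"
      using assms(1) orth E(3) by (auto simp: \<A>_def E_def[symmetric])
    have "orth E w Y X" if "Y \<in> \<B>0" "X \<in> \<A>" for X Y
      using that by (subst orth_sym) (simp add: \<A>_def)
    then show "\<B>0 \<subseteq> \<B>"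
      using assms(2) E(3) by (auto simp: \<B>_def)
  qed
  have "card R \<le> n + 1"
    using card_mono[of "{0..n}" R] unfolding R(1) by force
  have "card (E - R) = n + 1 - r"
    using RE E(1) unfolding r_def by (subst card_Diff_subset) (auto simp: E_def)
  then have cR: "real (card (E - R)) = real n + 1 - real r"
    using \<open>card R \<le> n + 1\<close> by (simp add: r_def of_nat_diff)
  define t where "t = 2 powr (real n + 2 - real r)"
  have "real n + 2 - real r = real (card (E - R) + 1)"
    using cR by simp
  then have t: "t = real (2 ^ (card (E - R) + 1))"
    unfolding t_def by (simp only: powr_realpow zero_less_numeral of_nat_power of_nat_numeral)
  obtain X Y where XY: "X \<in> \<A>" "Y \<in> \<B>"
    using assms(3,4) sub by (metis equals0I subsetD)
  have A: "t \<le> card \<A>"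
    unfolding t of_nat_le_iff \<A>_def
    by (rule card_orthogonal_complement_ge[OF E(1) RE R(2), of _ X]) (use XY(1) in \<open>simp add: \<A>_def\<close>)
  have B: "t \<le> card \<B>"
    unfolding t of_nat_le_iff \<B>_def
    by (rule card_orthogonal_complement_ge[OF E(1) RE R(2), of _ Y]) (use XY(2) in \<open>simp add: \<B>_def\<close>)
  have "card \<A> * card \<B> \<le> 2 ^ card R * 4 ^ card (E - R)"
  proof (rule card_orthogonal_families[OF E(1) _ _ _ RE])
    show "orth E w X Y" if "X \<in> \<A>" "Y \<in> \<B>" for X Y
      using that by (subst orth_sym) (simp add: \<B>_def)
  qed (auto simp: \<A>_def \<B>_def)
  then have "real (card \<A> * card \<B>) \<le> real (2 ^ card R * 4 ^ card (E - R))"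
    by (simp only: of_nat_le_iff)
  also have "\<dots> = 2 powr real r * (2 powr (2::real)) powr real (card (E - R))"
    by (simp add: powr_realpow r_def)
  \<comment> \<open>This brings the product bound into the shape \<open>t * u\<close> of
    \<open>sum_le_of_prod_le\<close>, with \<open>u = 2 powr n\<close>.\<close>
  also have "\<dots> = t * 2 powr n"
  proof -
    have "real r + 2 * (real n + 1 - real r) = (real n + 2 - real r) + real n"
      by (simp add: algebra_simps)
    then show ?thesis
      unfolding powr_powr cR t_def powr_add[symmetric] by (rule arg_cong)
  qed
  finally have "real (card \<A>) + real (card \<B>) \<le> t + 2 powr n"
    using A B by (intro sum_le_of_prod_le) (auto simp: t_def)
  moreover have "2 * card \<A>0 \<le> card \<A>"
    using E sub assms(1) by (intro double_card_le[of E 0]) (auto simp: \<A>_def orth_Compl)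
  moreover have "2 * card \<B>0 \<le> card \<B>"
    using E sub assms(2) by (intro double_card_le[of E 0]) (auto simp: \<B>_def orth_Compl)
  ultimately have "2 * real (card \<A>0 + card \<B>0) \<le> t + 2 powr n"
    unfolding of_nat_le_iff[where 'a = real, symmetric] by simp
  also have "\<dots> = 2 * (2 powr (real n + 1 - real r) + 2 powr (real n - 1))"
  proof -
    have double: "2 powr (c + 1) = 2 * 2 powr c" for c :: real
      by (simp add: powr_add)
    have "real n + 2 - real r = (real n + 1 - real r) + 1"
      by simp
    then have "t = 2 * 2 powr (real n + 1 - real r)"
      unfolding t_def by (simp only: double)
    then show ?thesis
      using double[of "real n - 1"] by simp
  qed
  finally show ?thesis
    by (simp add: r_def)
qed

section \<open>Multilinear polynomials\<close>

text \<open>Moebius inversion on the subset lattice, by recursion instead of an alternating sum. The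
  guard \<open>finite X\<close> sits inside the index set, so that infinite sets make no recursive
  call and the recursion terminates.\<close>

function moebius :: "('i set \<Rightarrow> real) \<Rightarrow> 'i set \<Rightarrow> real" where
  "moebius h X = h X - (\<Sum>T\<in>{T. finite X \<and> T \<subset> X}. moebius h T)"
  by pat_completeness auto
termination
  by (relation "inv_image finite_psubset snd") auto

declare moebius.simps [simp del]

lemma sum_moebius:
  assumes "finite X"
  shows "(\<Sum>T\<in>Pow X. moebius h T) = h X"
proof -
  have "Pow X = insert X {T. finite X \<and> T \<subset> X}"
    using assms by auto
  moreover have "finite {T. finite X \<and> T \<subset> X}"
    using assms by (auto intro: finite_subset[of _ "Pow X"])
  ultimately show ?thesis
    by (simp add: moebius.simps[of h X])
qed

text \<open>If the bits in \<open>S\<close> determine \<open>f\<close> on its domain, interpolation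
  on the cube over \<open>S\<close> gives a representing polynomial with variables in
  \<open>S\<close> only.\<close>

lemma depends_on_bits_le_card:
  assumes "depends_on_bits n f k" and S: "S \<subseteq> {0..<n}"
    and det: "\<And>x y. x \<in> dom_pbf n f \<Longrightarrow> y \<in> dom_pbf n f \<Longrightarrow>
      (\<And>i. i \<in> S \<Longrightarrow> x ! i = y ! i) \<Longrightarrow> f x = f y"
  shows "k \<le> card S"
proof -
  define ones where "ones x = {i\<in>S. x ! i}" for x :: "bool list"
  \<comment> \<open>Patterns on \<open>S\<close> that no domain point attains get the value
    0.\<close>
  define h :: "nat set \<Rightarrow> real" where
    "h X = (if \<exists>x\<in>dom_pbf n f. ones x = X \<and> f x = Some True then 1 else 0)" for X
  define c where "c T = (if T \<subseteq> S then moebius h T else 0)" for T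
  have finS: "finite S"
    using S by (rule finite_subset) simp
  have "mlpoly_eval n c x = h (ones x)" for x
  proof -
    have prod: "(\<Prod>i\<in>T. (if x ! i then 1 else 0 :: real)) = (if \<forall>i\<in>T. x ! i then 1 else 0)"
      if "finite T" for T
      using that by (induction T) auto
    \<comment> \<open>The coefficient vanishes when \<open>T\<close> leaves \<open>S\<close>, and
      the monomial vanishes when \<open>T\<close> contains a bit that is 0 in
      \<open>x\<close>.\<close>
    have "mlpoly_eval n c x = (\<Sum>T\<in>Pow (ones x). moebius h T)"
      unfolding mlpoly_eval_def
    proof (rule sum.mono_neutral_cong_right)
      show "\<forall>T\<in>Pow {0..<n} - Pow (ones x). c T * (\<Prod>i\<in>T. if x ! i then 1 else 0) = 0"
      proof
        fix T assume T: "T \<in> Pow {0..<n} - Pow (ones x)"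
        then have "finite T"
          by (auto intro: finite_subset)
        then show "c T * (\<Prod>i\<in>T. if x ! i then 1 else 0) = 0"
          using T by (auto simp: prod c_def ones_def)
      qed
      fix T assume T: "T \<in> Pow (ones x)"
      then have "finite T" "T \<subseteq> S"
        using finS by (auto simp: ones_def intro: finite_subset)
      then show "c T * (\<Prod>i\<in>T. if x ! i then 1 else 0) = moebius h T"
        using T by (auto simp: prod c_def ones_def)
    qed (use S in \<open>auto simp: ones_def\<close>)
    then show ?thesis
      using finS by (simp add: sum_moebius ones_def)
  qed
  moreover have "h (ones x) = (if f x = Some True then 1 else 0)" if x: "x \<in> dom_pbf n f" for x
  proof -
    have "f y = f x" if y: "y \<in> dom_pbf n f" "ones y = ones x" for y
      using y x by (intro det) (auto simp: ones_def)
    then have "(\<exists>y\<in>dom_pbf n f. ones y = ones x \<and> f y = Some True) \<longleftrightarrow> f x = Some True"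
      using x by metis
    then show ?thesis
      unfolding h_def by simp
  qed
  ultimately have "represents n c f"
    by (simp add: represents_def)
  then have "k \<le> card (mlpoly_vars n c)"
    using assms(1) unfolding depends_on_bits_def by (auto intro: Least_le)
  also have "\<dots> \<le> card S"
    using finS by (intro card_mono) (auto simp: mlpoly_vars_def c_def split: if_splits)
  finally show ?thesis .
qed

section \<open>Exact one-query algorithms\<close>

definition inner :: "nat \<Rightarrow> (nat \<Rightarrow> complex) \<Rightarrow> (nat \<Rightarrow> complex) \<Rightarrow> complex" where
  "inner d u v = (\<Sum>k<d. cnj (u k) * v k)"

text \<open>The shift by one matches the query positions: 0 never belongs to the set, so the sign
  vector has entry 1 there, as the oracle does.\<close>

definition support_set :: "nat \<Rightarrow> bool list \<Rightarrow> nat set" where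
  "support_set n x = {i\<in>{1..n}. x ! (i - 1)}"

lemma inner_self: "inner d v v = complex_of_real (vnorm2 d v)"
  unfolding inner_def vnorm2_def of_real_sum
  by (intro sum.cong) (simp_all add: mult.commute complex_norm_square[symmetric])

lemma inner_cong:
  assumes "\<And>k. k < d \<Longrightarrow> u k = u' k" "\<And>k. k < d \<Longrightarrow> v k = v' k"
  shows "inner d u v = inner d u' v'"
  using assms by (auto simp: inner_def intro: sum.cong)

lemma inner_mat_vec: "inner d u (mat_vec d A v) = inner d (mat_vec d (adj A) u) v"
  unfolding inner_def mat_vec_def adj_def cnj_sum sum_distrib_left sum_distrib_right
  by (subst sum.swap) (simp add: ac_simps)

lemma mat_vec_mat_mul: "mat_vec d (mat_mul d A B) v i = mat_vec d A (mat_vec d B v) i"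
  unfolding mat_vec_def mat_mul_def sum_distrib_left sum_distrib_right
  by (subst sum.swap) (simp add: ac_simps)

lemma mat_vec_cong:
  assumes "\<And>k. k < d \<Longrightarrow> A i k = B i k"
  shows "mat_vec d A v i = mat_vec d B v i"
  using assms by (auto simp: mat_vec_def intro: sum.cong)

lemma mat_vec_id: "i < d \<Longrightarrow> mat_vec d id_mat v i = v i"
  by (simp add: mat_vec_def id_mat_def if_distrib if_distribR sum.delta' cong: if_cong)

lemma inner_unitary:
  assumes "unitary d U"
  shows "inner d (mat_vec d U u) (mat_vec d U v) = inner d u v"
proof -
  have "mat_vec d (adj U) (mat_vec d U u) i = u i" if "i < d" for i
  proof -
    have "mat_vec d (adj U) (mat_vec d U u) i = mat_vec d (mat_mul d (adj U) U) u i"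
      by (rule mat_vec_mat_mul[symmetric])
    also have "\<dots> = mat_vec d id_mat u i"
      using assms that by (intro mat_vec_cong) (auto simp: unitary_def)
    finally show ?thesis
      using that by (simp add: mat_vec_id)
  qed
  then show ?thesis
    by (simp add: inner_mat_vec cong: inner_cong)
qed

lemma inner_orth_proj:
  assumes "orth_proj d P"
  shows "inner d (mat_vec d P u) v = inner d u (mat_vec d P v)"
  unfolding inner_mat_vec using assms
  by (intro inner_cong mat_vec_cong) (auto simp: orth_proj_def)

lemma inner_orth_proj_self:
  assumes "orth_proj d P"
  shows "inner d u (mat_vec d P u) = vnorm2 d (mat_vec d P u)"
proof -
  have "vnorm2 d (mat_vec d P u) = inner d u (mat_vec d P (mat_vec d P u))"
    by (simp add: inner_self[symmetric] inner_orth_proj[OF assms])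
  also have "\<dots> = inner d u (mat_vec d P u)"
    unfolding mat_vec_mat_mul[symmetric] using assms
    by (intro inner_cong mat_vec_cong) (auto simp: orth_proj_def mat_vec_mat_mul[symmetric]
        intro!: mat_vec_cong)
  finally show ?thesis ..
qed

lemma inner_proj_meas:
  assumes "proj_meas d P"
  shows "inner d u v = inner d u (mat_vec d (P b) v) + inner d u (mat_vec d (P (\<not> b)) v)"
proof -
  have P: "P b i j + P (\<not> b) i j = id_mat i j" if "i < d" "j < d" for i j
    using assms that by (cases b) (auto simp: proj_meas_def add.commute)
  have "v i = mat_vec d (P b) v i + mat_vec d (P (\<not> b)) v i" if "i < d" for i
  proof -
    have "v i = mat_vec d (\<lambda>i j. P b i j + P (\<not> b) i j) v i"
      using P that mat_vec_cong[of d "\<lambda>i j. P b i j + P (\<not> b) i j" i id_mat v]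
      by (simp add: mat_vec_id)
    then show ?thesis
      by (simp add: mat_vec_def distrib_right sum.distrib)
  qed
  then have "inner d u v = inner d u (\<lambda>i. mat_vec d (P b) v i + mat_vec d (P (\<not> b)) v i)"
    by (intro inner_cong) auto
  then show ?thesis
    by (simp add: inner_def distrib_left sum.distrib)
qed

lemma vnorm2_eq_0_iff: "vnorm2 d v = 0 \<longleftrightarrow> (\<forall>k<d. v k = 0)"
  by (auto simp: vnorm2_def sum_nonneg_eq_0_iff)

text \<open>The two outcome probabilities add up to \<open>vnorm2 d u\<close>, so a certain outcome
  leaves no amplitude for the other.\<close>

lemma complementary_outcome_zero:
  assumes "proj_meas d P" "vnorm2 d u = 1" "vnorm2 d (mat_vec d (P b) u) = 1" "k < d"
  shows "mat_vec d (P (\<not> b)) u k = 0"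
proof -
  have P: "orth_proj d (P c)" for c
    using assms(1) by (cases c) (auto simp: proj_meas_def)
  have "complex_of_real (vnorm2 d u) =
    complex_of_real (vnorm2 d (mat_vec d (P b) u) + vnorm2 d (mat_vec d (P (\<not> b)) u))"
    using inner_proj_meas[OF assms(1), of u u b] by (simp add: inner_self inner_orth_proj_self[OF P])
  then have "vnorm2 d (mat_vec d (P (\<not> b)) u) = 0"
    unfolding of_real_eq_iff using assms(2,3) by simp
  then show ?thesis
    using assms(4) by (simp add: vnorm2_eq_0_iff)
qed

text \<open>Split the inner product by the two projections: one term vanishes through
  \<open>v\<close>, the other through \<open>u\<close> once the projection is moved to the
  left.\<close>

lemma exact_outcomes_orthogonal:
  assumes "proj_meas d P" "vnorm2 d u = 1" "vnorm2 d v = 1"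
    and "vnorm2 d (mat_vec d (P b) u) = 1" "vnorm2 d (mat_vec d (P (\<not> b)) v) = 1"
  shows "inner d u v = 0"
proof -
  have P: "orth_proj d (P (\<not> b))"
    using assms(1) by (cases b) (auto simp: proj_meas_def)
  have "inner d u (mat_vec d (P b) v) = 0"
    using complementary_outcome_zero[OF assms(1,3,5)] by (simp add: inner_def)
  moreover have "inner d u (mat_vec d (P (\<not> b)) v) = 0"
    unfolding inner_orth_proj[OF P, symmetric]
    using complementary_outcome_zero[OF assms(1,2,4)] by (simp add: inner_def)
  ultimately show ?thesis
    using inner_proj_meas[OF assms(1), of u v b] by simp
qed

section \<open>The query operator and the weights of the query positions\<close>

lemma mat_vec_query_op:
  assumes "a < (n + 1) * m"
  shows "mat_vec ((n + 1) * m) (query_op m x) v a =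
    complex_of_real (chi (support_set n x) (a div m)) * v a"
proof -
  have "mat_vec ((n + 1) * m) (query_op m x) v a = query_op m x a a * v a"
    using assms by (simp add: mat_vec_def query_op_def if_distrib if_distribR sum.delta' cong: if_cong)
  moreover have "a div m \<le> n"
    using less_mult_imp_div_less[OF assms] by simp
  ultimately show ?thesis
    by (auto simp: query_op_def chi_def support_set_def Let_def)
qed

text \<open>\<open>U1\<close> preserves inner products and the query operator is a diagonal of
  signs. Hence the inner product of two final states is a signed sum of squared amplitudes before
  the query, grouped by query position.\<close>

lemma exact_1query_weights:
  assumes "exact_1query n f"
  obtains w :: "nat \<Rightarrow> real" where "(\<Sum>i\<in>{0..n}. w i) = 1"
    and "\<And>x y. x \<in> dom_pbf n f \<Longrightarrow> y \<in> dom_pbf n f \<Longrightarrow> f x \<noteq> f y \<Longrightarrow>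
      orth {0..n} w (support_set n x) (support_set n y)"
proof -
  obtain m U0 U1 \<psi> P where m: "0 < m" and U: "unitary ((n + 1) * m) U0" "unitary ((n + 1) * m) U1"
    and \<psi>: "vnorm2 ((n + 1) * m) \<psi> = 1" and P: "proj_meas ((n + 1) * m) P"
    and out: "\<And>x. x \<in> dom_pbf n f \<Longrightarrow>
      vnorm2 ((n + 1) * m) (mat_vec ((n + 1) * m) (P (the (f x))) (final_state n m U0 U1 \<psi> x)) = 1"
    using assms unfolding exact_1query_def Let_def by blast
  define d where "d = (n + 1) * m"
  define v where "v = mat_vec d U0 \<psi>"
  define \<phi> where "\<phi> = final_state n m U0 U1 \<psi>"
  define w where "w i = (\<Sum>a\<in>{a\<in>{..<d}. a div m = i}. (cmod (v a))\<^sup>2)" for i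
  have div: "(\<lambda>a. a div m) ` {..<d} \<subseteq> {0..n}"
    using less_mult_imp_div_less[of _ "n + 1" m] by (fastforce simp: d_def)
  have group: "(\<Sum>i\<in>{0..n}. w i * g i) = (\<Sum>a<d. (cmod (v a))\<^sup>2 * g (a div m))" for g
  proof -
    have "(\<Sum>i\<in>{0..n}. w i * g i) =
      (\<Sum>i\<in>{0..n}. \<Sum>a\<in>{a\<in>{..<d}. a div m = i}. (cmod (v a))\<^sup>2 * g (a div m))"
      unfolding w_def sum_distrib_right by (intro sum.cong) auto
    also have "\<dots> = (\<Sum>a<d. (cmod (v a))\<^sup>2 * g (a div m))"
      using div by (intro sum.group) auto
    finally show ?thesis .
  qed
  have "complex_of_real (vnorm2 d v) = complex_of_real (vnorm2 d \<psi>)"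
    using inner_unitary[OF U(1)] by (simp add: inner_self[symmetric] v_def d_def)
  then have v1: "vnorm2 d v = 1"
    using \<psi> by (simp add: d_def)
  have w1: "(\<Sum>i\<in>{0..n}. w i) = 1"
    using group[of "\<lambda>_. 1"] v1 by (simp add: vnorm2_def)
  have inner: "inner d (\<phi> x) (\<phi> y) =
    complex_of_real (\<Sum>i\<in>{0..n}. w i * chi (support_set n x) i * chi (support_set n y) i)" for x y
  proof -
    let ?X = "support_set n x" and ?Y = "support_set n y"
    have "inner d (\<phi> x) (\<phi> y) =
      inner d (mat_vec d (query_op m x) v) (mat_vec d (query_op m y) v)"
      using inner_unitary[OF U(2)] by (simp add: \<phi>_def final_state_def v_def d_def Let_def)
    also have "\<dots> = (\<Sum>a<d. complex_of_real ((cmod (v a))\<^sup>2 * (chi ?X (a div m) * chi ?Y (a div m))))"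
      unfolding inner_def
    proof (rule sum.cong)
      fix a assume "a \<in> {..<d}"
      then have O: "mat_vec d (query_op m z) v a =
        complex_of_real (chi (support_set n z) (a div m)) * v a" for z
        unfolding d_def by (intro mat_vec_query_op) simp
      have "complex_of_real ((cmod (v a))\<^sup>2) = v a * cnj (v a)"
        by (rule complex_norm_square)
      then show "cnj (mat_vec d (query_op m x) v a) * mat_vec d (query_op m y) v a =
        complex_of_real ((cmod (v a))\<^sup>2 * (chi ?X (a div m) * chi ?Y (a div m)))"
        unfolding O of_real_mult by (simp only: complex_cnj_mult complex_cnj_complex_of_real ac_simps)
    qed simp
    also have "\<dots> = complex_of_real (\<Sum>i\<in>{0..n}. w i * (chi ?X i * chi ?Y i))"
      unfolding group by simp
    finally show ?thesis
      by (simp add: mult.assoc)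
  qed
  have \<phi>1: "vnorm2 d (\<phi> x) = 1" for x
  proof -
    have "chi (support_set n x) i * chi (support_set n x) i = 1" for i
      by (simp add: chi_def)
    then have "complex_of_real (vnorm2 d (\<phi> x)) = 1"
      using inner[of x x] w1 by (simp add: inner_self mult.assoc)
    then show ?thesis
      by (simp only: of_real_eq_1_iff)
  qed
  have "orth {0..n} w (support_set n x) (support_set n y)"
    if xy: "x \<in> dom_pbf n f" "y \<in> dom_pbf n f" "f x \<noteq> f y" for x y
  proof -
    have "the (f y) = (\<not> the (f x))"
      using xy by (auto simp: dom_pbf_def)
    then have "inner d (\<phi> x) (\<phi> y) = 0"
      using exact_outcomes_orthogonal[of d P "\<phi> x" "\<phi> y" "the (f x)"] out[OF xy(1)] out[OF xy(2)]
        P \<phi>1 by (simp add: d_def \<phi>_def)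
    then show ?thesis
      unfolding inner orth_def by (simp only: of_real_eq_0_iff)
  qed
  then show ?thesis
    using that w1 by blast
qed

section \<open>Counting\<close>

text \<open>The single \<open>Y\<close> from the other side supplies the normal vector
  \<open>w i * chi Y i\<close> of a hyperplane containing \<open>A\<close>. A list of fixed length
  replaces the generating set to make counting easy.\<close>

lemma sign_span_generating_list:
  assumes "finite E" "A \<noteq> {}" "finite A" "e \<in> E" "w e \<noteq> 0"
    and orth: "\<And>X. X \<in> A \<Longrightarrow> orth E w X Y"
  shows "\<exists>zs. length zs = card E - 1 \<and> set zs \<subseteq> A \<and> A \<subseteq> sign_span E (set zs)"
proof -
  have "w e * chi Y e \<noteq> 0"
    using assms(5) by (simp add: chi_def)
  moreover have "(\<Sum>i\<in>E. (w i * chi Y i) * chi X i) = 0" if "X \<in> A" for X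
    using orth[OF that] by (simp add: orth_def mult.commute mult.left_commute)
  ultimately obtain G where G: "G \<subseteq> A" "card G < card E" "A \<subseteq> sign_span E G"
    using generating_subset_of_hyperplane[OF assms(3,1,4), of "\<lambda>i. w i * chi Y i" chi]
    unfolding sign_span_def by blast
  obtain xs where xs: "set xs = G" "length xs = card G"
    using G(1) assms(3) by (metis distinct_card finite_distinct_list finite_subset)
  obtain a where a: "a \<in> A"
    using assms(2) by blast
  \<comment> \<open>Padding with a member of \<open>A\<close> fixes the length and can only enlarge
    the span.\<close>
  define zs where "zs = xs @ replicate (card E - 1 - card G) a"
  have "length zs = card E - 1"
    using G(2) xs by (simp add: zs_def)
  moreover have "set zs \<subseteq> A"
    using xs G a by (auto simp: zs_def)
  moreover have "sign_span E G \<subseteq> sign_span E (set zs)"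
    using xs by (auto simp: sign_span_def zs_def)
  ultimately show ?thesis
    using G(3) by blast
qed

lemma inj_on_support_set: "inj_on (support_set n) {x. length x = n}"
proof (rule inj_onI)
  fix x y assume len: "x \<in> {x. length x = n}" "y \<in> {x. length x = n}"
    and eq: "support_set n x = support_set n y"
  show "x = y"
  proof (rule nth_equalityI)
    fix i assume "i < length x"
    then have "Suc i \<in> support_set n x \<longleftrightarrow> x ! i" "Suc i \<in> support_set n y \<longleftrightarrow> y ! i"
      using len by (auto simp: support_set_def)
    then show "x ! i = y ! i"
      using eq by blast
  qed (use len in auto)
qed

section \<open>Counting functions by pairs of spans\<close>

definition values_in :: "nat \<Rightarrow> nat set set \<Rightarrow> nat set set \<Rightarrow> (bool list \<Rightarrow> bool option) set" where
  "values_in n \<A> \<B> = {f\<in>pbf n. (\<forall>x. f x = Some False \<longrightarrow> support_set n x \<in> \<A>) \<and>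
    (\<forall>x. f x = Some True \<longrightarrow> support_set n x \<in> \<B>)}"

text \<open>A function is determined by its two preimages, hence by one subset of each family; that
  these preimages are disjoint is ignored in the upper bound.\<close>

lemma card_values_in:
  assumes "finite \<A>" "finite \<B>"
  shows "finite (values_in n \<A> \<B>)" "card (values_in n \<A> \<B>) \<le> 2 ^ (card \<A> + card \<B>)"
proof -
  define h where "h f = (support_set n ` {x. f x = Some False}, support_set n ` {x. f x = Some True})"
    for f :: "bool list \<Rightarrow> bool option"
  have len: "{x. f x = Some b} \<subseteq> {x. length x = n}" if "f \<in> values_in n \<A> \<B>" for f b
  proof -
    have "f x = None" if "length x \<noteq> n" for x
      using that \<open>f \<in> values_in n \<A> \<B>\<close> by (simp add: values_in_def pbf_def)
    then show ?thesis
      by (metis (mono_tags) mem_Collect_eq option.distinct(1) subsetI)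
  qed
  have "inj_on h (values_in n \<A> \<B>)"
  proof (rule inj_onI)
    fix f g assume fg: "f \<in> values_in n \<A> \<B>" "g \<in> values_in n \<A> \<B>" "h f = h g"
    have "{x. f x = Some b} = {x. g x = Some b}" for b
    proof -
      have "support_set n ` {x. f x = Some b} = support_set n ` {x. g x = Some b}"
        using fg(3) by (cases b) (simp_all add: h_def)
      then show ?thesis
        using inj_on_image_eq_iff[OF inj_on_support_set len[OF fg(1), of b] len[OF fg(2), of b]]
        by simp
    qed
    then have "f x = Some b \<longleftrightarrow> g x = Some b" for x b
      by blast
    then show "f = g"
      by (metis ext option.exhaust)
  qed
  moreover have "h ` values_in n \<A> \<B> \<subseteq> Pow \<A> \<times> Pow \<B>"
    by (auto simp: h_def values_in_def)
  moreover have "finite (Pow \<A> \<times> Pow \<B>)"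
    using assms by simp
  ultimately have "finite (values_in n \<A> \<B>)"
    and "card (values_in n \<A> \<B>) \<le> card (Pow \<A> \<times> Pow \<B>)"
    by (rule inj_on_finite, rule card_inj_on_le)
  then show "finite (values_in n \<A> \<B>)" "card (values_in n \<A> \<B>) \<le> 2 ^ (card \<A> + card \<B>)"
    using assms by (simp_all add: card_cartesian_product card_Pow power_add)
qed

text \<open>Intersecting with \<open>Pow {1..n}\<close> keeps the sign vectors with entry 1 at
  coordinate 0, those that come from inputs.\<close>

definition span_code :: "nat \<Rightarrow> nat set list \<Rightarrow> nat set set" where
  "span_code n zs = sign_span {0..n} (set zs) \<inter> Pow {1..n}"

definition codes :: "nat \<Rightarrow> nat set list set" where
  "codes n = {zs. set zs \<subseteq> Pow {1..n} \<and> length zs = n}"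

lemma finite_span_code: "finite (span_code n zs)"
  by (simp add: span_code_def)

text \<open>The weights and the two codes depend on \<open>f\<close>, but the size bound depends
  only on \<open>n\<close> and \<open>k\<close>; this makes a union bound over codes
  possible.\<close>

lemma exact_1query_span_codes:
  assumes f: "f \<in> pbf n" and dep: "depends_on_bits n f k" and "non_constant n f" "exact_1query n f"
  shows "\<exists>zs\<in>codes n. \<exists>ys\<in>codes n. f \<in> values_in n (span_code n zs) (span_code n ys) \<and>
    real (card (span_code n zs) + card (span_code n ys)) \<le>
      2 powr (real n + 1 - real k) + 2 powr (real n - 1)"
proof -
  obtain w where w: "(\<Sum>i\<in>{0..n}. w i) = 1"
    and worth: "\<And>x y. x \<in> dom_pbf n f \<Longrightarrow> y \<in> dom_pbf n f \<Longrightarrow> f x \<noteq> f y \<Longrightarrow>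
      orth {0..n} w (support_set n x) (support_set n y)"
    using exact_1query_weights[OF assms(4)] by blast
  define R where "R = {i\<in>{0..n}. w i \<noteq> 0}"
  obtain e where e: "e \<in> {0..n}" "w e \<noteq> 0"
    using w by (metis sum.neutral zero_neq_one)
  have "R \<noteq> {}" "finite R"
    using e by (auto simp: R_def)
  \<comment> \<open>The bits of nonzero weight in list indexing. \<open>Suc\<close> maps
    \<open>S\<close> into \<open>R\<close>, which may also contain 0.\<close>
  define S where "S = {i\<in>{0..<n}. w (Suc i) \<noteq> 0}"
  have "k \<le> card S"
  proof (rule depends_on_bits_le_card[OF dep])
    show "S \<subseteq> {0..<n}"
      by (auto simp: S_def)
    fix x y assume xy: "x \<in> dom_pbf n f" "y \<in> dom_pbf n f" "\<And>i. i \<in> S \<Longrightarrow> x ! i = y ! i"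
    show "f x = f y"
    proof (rule ccontr)
      assume "f x \<noteq> f y"
      then have "orth {0..n} w (support_set n x) (support_set n y)"
        using worth xy by blast
      \<comment> \<open>Inputs that agree wherever the weight is nonzero would be orthogonal to
        themselves, making the total weight 0 instead of 1.\<close>
      moreover have "i \<in> support_set n x \<longleftrightarrow> i \<in> support_set n y" if "i \<in> {0..n}" "w i \<noteq> 0" for i
        using that xy(3)[of "i - 1"] by (cases i) (auto simp: support_set_def S_def)
      ultimately have "orth {0..n} w (support_set n y) (support_set n y)"
        by (subst (asm) orth_cong[of _ _ _ "support_set n y"]) auto
      moreover have "w i * chi Z i * chi Z i = w i" for i Z
        by (simp add: chi_def)
      ultimately show False
        using w by (simp add: orth_def)
    qed
  qed
  also have "card S = card (Suc ` S)"
    by (simp add: card_image)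
  also have "\<dots> \<le> card R"
    using \<open>finite R\<close> by (intro card_mono) (auto simp: S_def R_def)
  finally have kR: "k \<le> card R" .
  define V where "V b = support_set n ` {x\<in>dom_pbf n f. f x = Some b}" for b
  have VP: "V b \<subseteq> Pow {1..n}" for b
    by (auto simp: V_def support_set_def)
  then have finV: "finite (V b)" for b
    using finite_subset[of "V b" "Pow {1..n}"] by simp
  have Vne: "V b \<noteq> {}" for b
  proof -
    obtain x y where xy: "x \<in> dom_pbf n f" "y \<in> dom_pbf n f" "f x \<noteq> f y"
      using assms(3) by (auto simp: non_constant_def)
    then have "f x = Some b \<or> f y = Some b"
      by (auto simp: dom_pbf_def)
    then show ?thesis
      using xy by (auto simp: V_def)
  qed
  have Vorth: "orth {0..n} w X Y" if "X \<in> V b" "Y \<in> V (\<not> b)" for X Y b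
    using that worth by (auto simp: V_def)
  have "\<exists>zs\<in>codes n. set zs \<subseteq> V b \<and> V b \<subseteq> span_code n zs" for b
  proof -
    obtain Y where "Y \<in> V (\<not> b)"
      using Vne by blast
    then have "\<exists>zs. length zs = card {0..n} - 1 \<and> set zs \<subseteq> V b \<and>
        V b \<subseteq> sign_span {0..n} (set zs)"
      using Vorth Vne finV e by (intro sign_span_generating_list) auto
    then show ?thesis
      using VP[of b] by (fastforce simp: codes_def span_code_def)
  qed
  then obtain zs where zs: "\<And>b. zs b \<in> codes n" "\<And>b. set (zs b) \<subseteq> V b"
    "\<And>b. V b \<subseteq> span_code n (zs b)"
    by metis
  have "f \<in> values_in n (span_code n (zs False)) (span_code n (zs True))"
  proof -
    have "support_set n x \<in> span_code n (zs b)" if "f x = Some b" for x b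
      using that f zs(3)[of b] by (force simp: V_def dom_pbf_def pbf_def)
    then show ?thesis
      using f by (simp add: values_in_def)
  qed
  moreover have "real (card (span_code n (zs False)) + card (span_code n (zs True))) \<le>
      2 powr (real n + 1 - real (card R)) + 2 powr (real n - 1)"
  proof (rule card_sum_orthogonal_families[OF _ _ _ _ _ R_def \<open>R \<noteq> {}\<close>])
    show "orth {0..n} w X Y"
      if "X \<in> span_code n (zs False)" "Y \<in> span_code n (zs True)" for X Y
    proof (rule orth_sign_span)
      show "orth {0..n} w X Y" if "X \<in> set (zs False)" "Y \<in> set (zs True)" for X Y
        using that zs(2) Vorth[of X False Y] by auto
    qed (use that in \<open>auto simp: span_code_def\<close>)
    show "span_code n (zs False) \<noteq> {}" "span_code n (zs True) \<noteq> {}"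
      using zs(3) Vne by (metis subset_empty)+
  qed (auto simp: span_code_def)
  \<comment> \<open>The bound decreases in the number of nonzero weights, so
    \<open>k \<le> card R\<close> lets \<open>k\<close> replace it.\<close>
  moreover have "2 powr (real n + 1 - real (card R)) \<le> 2 powr (real n + 1 - real k)"
    using kR by simp
  ultimately show ?thesis
    using zs(1) by (meson add_right_mono order_trans)
qed

lemma card_codes: "finite (codes n)" "card (codes n) = 2 ^ n\<^sup>2"
  unfolding codes_def
  by (simp_all add: finite_lists_length_eq card_lists_length_eq card_Pow power2_eq_square power_mult)

theorem theorem5:
  fixes n k :: nat
  assumes "n \<ge> 3" and "k \<ge> 2"
  shows "real (N1 n k) \<le> (real n)\<^sup>2 *
           2 powr (2 ^ (n - 1) * (1 + 2 powr (2 - real k)) + 2 * (real n)\<^sup>2)"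
proof -
  define M :: real where "M = 2 ^ (n - 1) * (1 + 2 powr (2 - real k))"
  define F where "F = {f \<in> pbf n. depends_on_bits n f k \<and> non_constant n f \<and> exact_1query n f}"
  \<comment> \<open>Only pairs of codes with small spans are kept: each of them admits at most
    \<open>2 powr M\<close> functions, and they still cover \<open>F\<close>.\<close>
  define C where "C = {(zs, ys) \<in> codes n \<times> codes n.
    real (card (span_code n zs) + card (span_code n ys)) \<le> M}"
  define T where "T = (\<lambda>(zs, ys). values_in n (span_code n zs) (span_code n ys))"
  have pow: "2 ^ (n - 1) = (2::real) powr (real n - 1)"
    using assms(1) by (simp add: powr_realpow[symmetric] of_nat_diff)
  have "2 powr (real n - 1) * 2 powr (2 - real k) = 2 powr (real n + 1 - real k)"
    unfolding powr_add[symmetric] by (rule arg_cong) simp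
  then have M: "M = 2 powr (real n + 1 - real k) + 2 powr (real n - 1)"
    unfolding M_def pow by (simp add: distrib_left)
  have C: "finite C" "card C \<le> 2 ^ (2 * n\<^sup>2)"
  proof -
    have "C \<subseteq> codes n \<times> codes n"
      by (auto simp: C_def)
    moreover have "finite (codes n \<times> codes n)"
      using card_codes by simp
    ultimately have "finite C" "card C \<le> card (codes n \<times> codes n)"
      by (rule finite_subset, intro card_mono)
    then show "finite C" "card C \<le> 2 ^ (2 * n\<^sup>2)"
      by (simp_all add: card_cartesian_product card_codes mult_2 power_add)
  qed
  have T: "finite (T p)" "real (card (T p)) \<le> 2 powr M" if "p \<in> C" for p
  proof -
    obtain zs ys where p: "p = (zs, ys)"
      by (cases p)
    show "finite (T p)"
      by (simp add: p T_def card_values_in finite_span_code)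
    have "real (card (T p)) \<le> real (2 ^ (card (span_code n zs) + card (span_code n ys)))"
      unfolding p T_def of_nat_le_iff by (simp add: card_values_in finite_span_code)
    also have "\<dots> = 2 powr real (card (span_code n zs) + card (span_code n ys))"
      by (subst powr_realpow) simp_all
    also have "\<dots> \<le> 2 powr M"
      using that by (intro powr_mono) (simp_all add: p C_def)
    finally show "real (card (T p)) \<le> 2 powr M" .
  qed
  have "F \<subseteq> (\<Union>p\<in>C. T p)"
    using exact_1query_span_codes[of _ n k] unfolding F_def C_def T_def M by fast
  then have "card F \<le> card (\<Union>p\<in>C. T p)"
    using C T by (intro card_mono) auto
  also have "\<dots> \<le> (\<Sum>p\<in>C. card (T p))"
    using C(1) by (rule card_UN_le)
  finally have "real (card F) \<le> (\<Sum>p\<in>C. real (card (T p)))"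
    by (metis of_nat_le_iff of_nat_sum)
  also have "\<dots> \<le> real (card C) * 2 powr M"
    using T by (intro sum_bounded_above) auto
  also have "\<dots> \<le> 2 ^ (2 * n\<^sup>2) * 2 powr M"
    using of_nat_mono[OF C(2), where 'a = real] by (intro mult_right_mono) simp_all
  also have "\<dots> = 2 powr (M + 2 * (real n)\<^sup>2)"
    by (simp add: powr_add powr_realpow[symmetric])
  also have "\<dots> \<le> (real n)\<^sup>2 * 2 powr (M + 2 * (real n)\<^sup>2)"
  proof -
    have "1 \<le> (real n)\<^sup>2"
      using assms(1) by (intro one_le_power) simp
    then show ?thesis
      using mult_right_mono[of 1 "(real n)\<^sup>2" "2 powr (M + 2 * (real n)\<^sup>2)"] by simp
  qed
  finally show ?thesis
    by (simp add: N1_def F_def M_def)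
qed

end
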